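(* Let $r,s,t,p$ be positive integers with $(r,s)\neq(t,p)$, and let $\varphi:\mathbb{R}_+^4\to\mathbb{R}_+^4$ be the map $$\varphi(x_1,x_2,x_3,x_4)=(x_3,x_4,x_5,x_6),\qquad x_5=\frac{x_2^rx_3^sx_4^t+1}{x_1},\quad x_6=\frac{x_3^tx_4^px_5^r+1}{x_2}.$$ Then $\varphi$ is a Poisson map with respect to the Poisson bracket on $\mathbb{R}_+^4$ given by $\{x_i,x_j\}=c_{ij}x_ix_j$, $i,j\in\{1,2,3,4\}$, where $$C=[c_{ij}]=\begin{bmatrix} 0 & r & -p & t \\ -r & 0 & t & -s \\ p & -t & 0 & r \\ -t & s & -r & 0 \end{bmatrix}.$$
   Context: $\mathbb{R}_+$ denotes the positive reals. A map $\varphi:M\to M$ is a Poisson map with respect to a Poisson bracket $\{\,,\}$ on $M$ if $\{f\circ\varphi,g\circ\varphi\}=\{f,g\}\circ\varphi$ for all $f,g\in C^\infty(M)$. For a skew-symmetric matrix $C$, the relations $\{x_i,x_j\}=c_{ij}x_ix_j$ on the coordinate functions determine the Poisson bracket on $C^\infty(\mathbb{R}_+^N)$ through $\{f,g\}=\sum_{i,j}c_{ij}x_ix_j\frac{\partial f}{\partial x_i}\frac{\partial g}{\partial x_j}$. *)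

theory Defs
  imports "HOL-Analysis.Analysis"
begin

text \<open>Functions on an open set \<open>M\<close> are represented by total functions; only their values on \<open>M\<close>
  matter. For open \<open>M\<close>, \<open>Ck_on k M f\<close> says that \<open>f\<close> is of class \<open>C\<^sup>k\<close> on \<open>M\<close>.\<close>

fun Ck_on :: "nat \<Rightarrow> 'a::real_normed_vector set \<Rightarrow> ('a \<Rightarrow> 'b::real_normed_vector) \<Rightarrow> bool" where
  "Ck_on 0 M f \<longleftrightarrow> continuous_on M f"
| "Ck_on (Suc k) M f \<longleftrightarrow> (\<forall>x\<in>M. f differentiable (at x)) \<and>
     (\<forall>v. Ck_on k M (\<lambda>x. frechet_derivative f (at x) v))"

definition Cinf :: "'a::real_normed_vector set \<Rightarrow> ('a \<Rightarrow> real) set" where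
  "Cinf M = {f. \<forall>k. Ck_on k M f}"

definition pos_orthant :: "(real ^ 'n) set" where
  "pos_orthant = {x. \<forall>i. 0 < x $ i}"

definition partial_deriv :: "'n \<Rightarrow> (real ^ 'n \<Rightarrow> real) \<Rightarrow> real ^ 'n \<Rightarrow> real" where
  "partial_deriv i f x = frechet_derivative f (at x) (axis i 1)"

definition log_canonical_bracket ::
  "real ^ 'n ^ 'n \<Rightarrow> (real ^ 'n \<Rightarrow> real) \<Rightarrow> (real ^ 'n \<Rightarrow> real) \<Rightarrow> real ^ 'n \<Rightarrow> real" where
  "log_canonical_bracket C f g x =
     (\<Sum>i\<in>UNIV. \<Sum>j\<in>UNIV. C $ i $ j * x $ i * x $ j * partial_deriv i f x * partial_deriv j g x)"

lemma log_canonical_bracket_coords: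
  "log_canonical_bracket C (\<lambda>x. x $ i) (\<lambda>x. x $ j) x = C $ i $ j * x $ i * x $ j"
proof -
  have D: "partial_deriv k (\<lambda>x. x $ l) x = (if k = l then 1 else 0)" for k l
  proof -
    have "((\<lambda>x. x $ l) has_derivative (\<lambda>h. h $ l)) (at x)"
      by (rule bounded_linear_imp_has_derivative) (rule bounded_linear_vec_nth)
    from frechet_derivative_at[OF this, symmetric] show ?thesis
      by (simp add: partial_deriv_def axis_def)
  qed
  have "log_canonical_bracket C (\<lambda>x. x $ i) (\<lambda>x. x $ j) x =
      (\<Sum>k\<in>UNIV. \<Sum>l\<in>UNIV. if l = j then if k = i then C $ k $ l * x $ k * x $ l else 0 else 0)"
    unfolding log_canonical_bracket_def D by (intro sum.cong refl) auto
  then show ?thesis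
    by simp
qed

text \<open>The first two conjuncts express that \<open>\<phi>\<close> is a map \<open>M \<rightarrow> M\<close> and that \<open>f \<circ> \<phi>\<close> and
  \<open>g \<circ> \<phi>\<close> are in the domain of the bracket.\<close>

definition poisson_map ::
  "'a::real_normed_vector set \<Rightarrow> (('a \<Rightarrow> real) \<Rightarrow> ('a \<Rightarrow> real) \<Rightarrow> 'a \<Rightarrow> real) \<Rightarrow> ('a \<Rightarrow> 'a) \<Rightarrow> bool"
  where
  "poisson_map M B \<phi> \<longleftrightarrow>
     \<phi> ` M \<subseteq> M \<and>
     (\<forall>f\<in>Cinf M. f \<circ> \<phi> \<in> Cinf M) \<and>
     (\<forall>f\<in>Cinf M. \<forall>g\<in>Cinf M. \<forall>x\<in>M. B (f \<circ> \<phi>) (g \<circ> \<phi>) x = (B f g \<circ> \<phi>) x)"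

lemma vector_4 [simp]:
  "(vector [a, b, c, d] :: 'a::zero ^ 4) $ 1 = a"
  "(vector [a, b, c, d] :: 'a::zero ^ 4) $ 2 = b"
  "(vector [a, b, c, d] :: 'a::zero ^ 4) $ 3 = c"
  "(vector [a, b, c, d] :: 'a::zero ^ 4) $ 4 = d"
  by (simp_all add: vector_def)

definition phi :: "nat \<Rightarrow> nat \<Rightarrow> nat \<Rightarrow> nat \<Rightarrow> real ^ 4 \<Rightarrow> real ^ 4" where
  "phi r s t p x =
     (let x5 = (x $ 2 ^ r * x $ 3 ^ s * x $ 4 ^ t + 1) / x $ 1;
          x6 = (x $ 3 ^ t * x $ 4 ^ p * x5 ^ r + 1) / x $ 2
      in vector [x $ 3, x $ 4, x5, x6])"

definition coeff_matrix :: "nat \<Rightarrow> nat \<Rightarrow> nat \<Rightarrow> nat \<Rightarrow> real ^ 4 ^ 4" where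
  "coeff_matrix r s t p = vector
     [vector [0, real r, - real p, real t],
      vector [- real r, 0, real t, - real s],
      vector [real p, - real t, 0, real r],
      vector [- real t, real s, - real r, 0]]"

lemma coeff_matrix_skew: "transpose (coeff_matrix r s t p) = - coeff_matrix r s t p"
  by (simp add: vec_eq_iff forall_4 transpose_def coeff_matrix_def)

end

theory Submission
  imports Defs
begin

text \<open>In logarithmic coordinates the bracket is the constant bilinear form given by \<open>C\<close>, so only the
  logarithmic gradients of the components of \<open>\<phi>\<close> matter. With \<open>m = x\<^sub>2\<^sup>r x\<^sub>3\<^sup>s x\<^sub>4\<^sup>t\<close> one has
  \<open>d log x\<^sub>5 = m / (m + 1) d log m - d log x\<^sub>1\<close>, and \<open>C\<close> is such that \<open>m\<close> Poisson commutes with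
  \<open>x\<^sub>2, x\<^sub>3, x\<^sub>4\<close>; the coefficient \<open>m / (m + 1)\<close> therefore drops out of the brackets of
  \<open>x\<^sub>5\<close> with these coordinates. The same happens for \<open>x\<^sub>6\<close>, whose monomial commutes with
  \<open>x\<^sub>3, x\<^sub>4, x\<^sub>5\<close>.\<close>

section \<open>Functions of class \<open>C\<^sup>k\<close>\<close>

lemma frechet_derivative_eqI:
  "(f has_derivative f') (at x) \<Longrightarrow> frechet_derivative f (at x) = f'"
  using frechet_derivative_at by metis

text \<open>Around a point of an open set, agreement on the set is agreement near the point, so
  derivatives agree there as well. Values outside \<open>M\<close> therefore never enter, at any
  order.\<close>

lemma Ck_on_cong:
  assumes "open M" "\<And>x. x \<in> M \<Longrightarrow> f x = g x" "Ck_on k M f"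
  shows "Ck_on k M g"
  using assms
proof (induction k arbitrary: f g)
  case 0
  then show ?case by (simp cong: continuous_on_cong)
next
  case (Suc k)
  have D: "(g has_derivative frechet_derivative f (at x)) (at x)" if "x \<in> M" for x
  proof (rule has_derivative_transform_within_open[OF _ \<open>open M\<close> that])
    show "(f has_derivative frechet_derivative f (at x)) (at x)"
      using Suc.prems that by (simp add: frechet_derivative_works)
  qed (simp add: Suc.prems)
  then have "g differentiable (at x)" if "x \<in> M" for x
    using that differentiableI by blast
  moreover have "Ck_on k M (\<lambda>x. frechet_derivative g (at x) v)" for v
  proof (rule Suc.IH[OF \<open>open M\<close>])
    show "Ck_on k M (\<lambda>x. frechet_derivative f (at x) v)" using Suc.prems by simp
  qed (simp add: frechet_derivative_eqI[OF D])
  ultimately show ?case by simp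
qed

text \<open>This makes induction on \<open>k\<close> workable: a derivative formula valid only on
  \<open>M\<close> may replace the total function \<open>frechet_derivative\<close>, thanks to
  \<open>Ck_on_cong\<close>.\<close>

lemma Ck_on_SucI:
  assumes "open M" "\<And>x. x \<in> M \<Longrightarrow> (f has_derivative f' x) (at x)"
    "\<And>v. Ck_on k M (\<lambda>x. f' x v)"
  shows "Ck_on (Suc k) M f"
proof -
  have "Ck_on k M (\<lambda>x. frechet_derivative f (at x) v)" for v
    by (rule Ck_on_cong[OF assms(1) _ assms(3)])
      (simp add: frechet_derivative_eqI[OF assms(2)])
  with assms(2) show ?thesis by (auto intro: differentiableI)
qed

lemma Ck_on_SucD_has_derivative:
  "Ck_on (Suc k) M f \<Longrightarrow> x \<in> M \<Longrightarrow> (f has_derivative frechet_derivative f (at x)) (at x)"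
  by (simp add: frechet_derivative_works)

text \<open>Differentiability gives continuity at the bottom; above it, the claim passes to the
  directional derivatives. It is needed wherever a derivative formula still contains the
  undifferentiated functions, as in the product rule.\<close>

lemma Ck_on_SucD: "Ck_on (Suc k) M f \<Longrightarrow> Ck_on k M f"
proof (induction k arbitrary: f)
  case 0
  then show ?case
    by (auto intro!: continuous_at_imp_continuous_on differentiable_imp_continuous_within)
next
  case (Suc k)
  then show ?case by (metis Ck_on.simps(2))
qed

section \<open>Closure of class \<open>Ck_on\<close> under algebraic operations\<close>

lemma Ck_on_const: "open M \<Longrightarrow> Ck_on k M (\<lambda>x. c)"
proof (induction k arbitrary: c)
  case (Suc k)
  then show ?case by (intro Ck_on_SucI[where f' = "\<lambda>x v. 0"]) auto
qed simp

lemma Ck_on_bounded_linear: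
  assumes "open M" "bounded_linear f"
  shows "Ck_on k M f"
proof (cases k)
  case 0
  then show ?thesis using assms by (simp add: linear_continuous_on)
next
  case (Suc n)
  show ?thesis
    unfolding Suc using assms
    by (intro Ck_on_SucI[where f' = "\<lambda>x. f"] Ck_on_const bounded_linear_imp_has_derivative)
qed

lemma Ck_on_add:
  "open M \<Longrightarrow> Ck_on k M f \<Longrightarrow> Ck_on k M g \<Longrightarrow> Ck_on k M (\<lambda>x. f x + g x)"
proof (induction k arbitrary: f g)
  case 0
  then show ?case by (simp add: continuous_on_add)
next
  case (Suc k)
  show ?case
    by (rule Ck_on_SucI[OF \<open>open M\<close> has_derivative_add[OF
            Ck_on_SucD_has_derivative[OF Suc.prems(2)] Ck_on_SucD_has_derivative[OF Suc.prems(3)]]])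
      (use Suc in auto)
qed

lemma Ck_on_sum:
  "open M \<Longrightarrow> (\<And>i. i \<in> I \<Longrightarrow> Ck_on k M (f i)) \<Longrightarrow> Ck_on k M (\<lambda>x. \<Sum>i\<in>I. f i x)"
  by (induction I rule: infinite_finite_induct) (auto intro: Ck_on_const Ck_on_add)

lemma Ck_on_mult:
  fixes f g :: "'a::real_normed_vector \<Rightarrow> 'b::real_normed_algebra"
  shows "open M \<Longrightarrow> Ck_on k M f \<Longrightarrow> Ck_on k M g \<Longrightarrow> Ck_on k M (\<lambda>x. f x * g x)"
proof (induction k arbitrary: f g)
  case 0
  then show ?case by (simp add: continuous_on_mult)
next
  case (Suc k)
  show ?case
    by (rule Ck_on_SucI[OF \<open>open M\<close> has_derivative_mult[OF
            Ck_on_SucD_has_derivative[OF Suc.prems(2)] Ck_on_SucD_has_derivative[OF Suc.prems(3)]]])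
      (use Suc Suc.prems(2,3)[THEN Ck_on_SucD] in \<open>auto intro!: Ck_on_add\<close>)
qed

lemma Ck_on_power:
  fixes f :: "'a::real_normed_vector \<Rightarrow> 'b::real_normed_algebra_1"
  shows "open M \<Longrightarrow> Ck_on k M f \<Longrightarrow> Ck_on k M (\<lambda>x. f x ^ n)"
  by (induction n) (auto intro: Ck_on_const Ck_on_mult)

text \<open>The derivative of 1/f involves only 1/f and the derivative of f, so the induction closes
  with f fixed.\<close>

lemma Ck_on_inverse:
  fixes f :: "'a::real_normed_vector \<Rightarrow> real"
  assumes "open M" "\<And>x. x \<in> M \<Longrightarrow> f x \<noteq> 0"
  shows "Ck_on k M f \<Longrightarrow> Ck_on k M (\<lambda>x. inverse (f x))"
proof (induction k)
  case 0
  then show ?case using assms by (simp add: continuous_on_inverse)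
next
  case (Suc k)
  note IH = Suc.IH[OF Ck_on_SucD[OF Suc.prems]]
  show ?case
  proof (rule Ck_on_SucI[OF \<open>open M\<close>])
    \<comment> \<open>The sign is written as a factor -1 so that the rules for products and
      constants cover it.\<close>
    show "((\<lambda>x. inverse (f x)) has_derivative
        (\<lambda>h. (- 1) * (inverse (f x) * frechet_derivative f (at x) h * inverse (f x)))) (at x)"
      if "x \<in> M" for x
      using Deriv.has_derivative_inverse[OF assms(2)[OF that] Ck_on_SucD_has_derivative[OF Suc.prems that]]
      by simp
    show "Ck_on k M
        (\<lambda>x. (- 1) * (inverse (f x) * frechet_derivative f (at x) v * inverse (f x)))" for v
      by (intro Ck_on_mult Ck_on_const IH assms(1)) (use Suc.prems in simp)
  qed
qed

lemma Ck_on_divide: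
  fixes f g :: "'a::real_normed_vector \<Rightarrow> real"
  assumes "open M" "Ck_on k M f" "Ck_on k M g" "\<And>x. x \<in> M \<Longrightarrow> g x \<noteq> 0"
  shows "Ck_on k M (\<lambda>x. f x / g x)"
  unfolding divide_inverse using assms by (intro Ck_on_mult Ck_on_inverse)

section \<open>Chain rule and smooth composition in coordinates\<close>

lemma has_derivative_comp_vec:
  fixes f :: "real ^ 'n \<Rightarrow> real"
  assumes f: "f differentiable (at (\<phi> x))"
    and \<phi>: "\<And>i. ((\<lambda>y. \<phi> y $ i) has_derivative \<phi>' i) (at x)"
  shows "((f \<circ> \<phi>) has_derivative (\<lambda>h. \<Sum>i\<in>UNIV. partial_deriv i f (\<phi> x) * \<phi>' i h)) (at x)"
proof -
  let ?F = "frechet_derivative f (at (\<phi> x))"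
  have F: "(f has_derivative ?F) (at (\<phi> x))"
    using f by (simp add: frechet_derivative_works)
  then have lin: "linear ?F" by (rule has_derivative_linear)
  have "(\<phi> has_derivative (\<lambda>h. \<chi> i. \<phi>' i h)) (at x)"
    unfolding has_derivative_componentwise_within[of \<phi>] Basis_vec_def
    by (auto simp: inner_axis \<phi>)
  from diff_chain_at[OF this F]
  have "((f \<circ> \<phi>) has_derivative (\<lambda>h. ?F (\<chi> i. \<phi>' i h))) (at x)"
    by (simp add: o_def)
  \<comment> \<open>Expanding \<open>v\<close> in the standard basis turns the derivative of
    \<open>f\<close> into its partial derivatives, which are the quantities occurring in the
    bracket.\<close>
  moreover have "?F v = (\<Sum>i\<in>UNIV. partial_deriv i f (\<phi> x) * v $ i)" for v
  proof -
    have "?F v = ?F (\<Sum>i\<in>UNIV. v $ i *\<^sub>R axis i 1)"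
      by (simp add: basis_expansion flip: scalar_mult_eq_scaleR)
    also have "\<dots> = (\<Sum>i\<in>UNIV. partial_deriv i f (\<phi> x) * v $ i)"
      by (simp add: linear_sum[OF lin] linear_scale[OF lin] partial_deriv_def mult.commute)
    finally show ?thesis .
  qed
  ultimately show ?thesis by simp
qed

text \<open>By the chain rule, a directional derivative of the composite is a sum of products of
  \<open>partial_deriv i f \<circ> \<phi>\<close> with derivatives of components of \<phi>. The
  induction varies \<open>f\<close>, so it applies to the partial derivatives.\<close>

lemma Ck_on_comp:
  fixes f :: "real ^ 'n \<Rightarrow> real"
  assumes "open M" "\<phi> ` M \<subseteq> N"
  shows "Ck_on k N f \<Longrightarrow> (\<And>i. Ck_on k M (\<lambda>x. \<phi> x $ i)) \<Longrightarrow> Ck_on k M (f \<circ> \<phi>)"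
proof (induction k arbitrary: f)
  case 0
  have "continuous_on M (\<lambda>x. \<chi> i. \<phi> x $ i)"
    using 0 by (intro continuous_on_vec_lambda) simp
  then have "continuous_on M \<phi>" by simp
  moreover have "continuous_on (\<phi> ` M) f"
    using 0 assms(2) by (auto intro: continuous_on_subset)
  ultimately show ?case by (simp only: Ck_on.simps continuous_on_compose)
next
  case (Suc k)
  show ?case
  proof (rule Ck_on_SucI[OF \<open>open M\<close>])
    show "((f \<circ> \<phi>) has_derivative (\<lambda>h. \<Sum>i\<in>UNIV. partial_deriv i f (\<phi> x) *
        frechet_derivative (\<lambda>y. \<phi> y $ i) (at x) h)) (at x)" if "x \<in> M" for x
      using Suc.prems(1) assms(2) that Ck_on_SucD_has_derivative[OF Suc.prems(2)]
      by (intro has_derivative_comp_vec) auto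
    have "Ck_on k M (partial_deriv i f \<circ> \<phi>)" for i
    proof (rule Suc.IH)
      show "Ck_on k N (partial_deriv i f)"
        using Suc.prems(1) by (simp add: partial_deriv_def[abs_def])
    qed (rule Ck_on_SucD[OF Suc.prems(2)])
    then show "Ck_on k M (\<lambda>x. \<Sum>i\<in>UNIV. partial_deriv i f (\<phi> x) *
        frechet_derivative (\<lambda>y. \<phi> y $ i) (at x) v)" for v
      using Suc.prems(2) by (intro Ck_on_sum Ck_on_mult \<open>open M\<close>) (simp_all add: o_def)
  qed
qed

lemma Cinf_comp:
  fixes f :: "real ^ 'n \<Rightarrow> real"
  assumes "open M" "\<phi> ` M \<subseteq> N" "f \<in> Cinf N" "\<And>k i. Ck_on k M (\<lambda>x. \<phi> x $ i)"
  shows "f \<circ> \<phi> \<in> Cinf M"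
  using assms Ck_on_comp[OF assms(1,2)] by (simp add: Cinf_def)

lemma Cinf_differentiable: "f \<in> Cinf M \<Longrightarrow> x \<in> M \<Longrightarrow> f differentiable (at x)"
  unfolding Cinf_def using Ck_on.simps(2) by blast

lemma open_pos_orthant: "open (pos_orthant :: (real ^ 'n) set)"
proof -
  have "pos_orthant = (\<Inter>i. {x :: real ^ 'n. 0 < x $ i})"
    by (auto simp: pos_orthant_def)
  moreover have "open (\<Inter>i. {x :: real ^ 'n. 0 < x $ i})"
    by (intro open_INT ballI open_Collect_less continuous_intros) simp
  ultimately show ?thesis by simp
qed

section \<open>Logarithmic gradients\<close>

text \<open>For positive \<open>u\<close>, \<open>a\<close> is the gradient of log u in the
  coordinates log x_i, that is, a_i = x_i (du/dx_i) / u. Multiplying by \<open>u x\<close> avoids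
  any logarithm.\<close>

definition has_log_grad ::
  "(real ^ 'n \<Rightarrow> real) \<Rightarrow> real ^ 'n \<Rightarrow> real ^ 'n \<Rightarrow> bool" where
  "has_log_grad u a x \<longleftrightarrow> (u has_derivative (\<lambda>h. u x * (\<Sum>i\<in>UNIV. a $ i * h $ i / x $ i))) (at x)"

lemma has_log_grad_coord:
  assumes "x \<in> pos_orthant"
  shows "has_log_grad (\<lambda>y. y $ i) (axis i 1) x"
proof -
  have "x $ i \<noteq> 0" using assms by (simp add: pos_orthant_def less_imp_neq[THEN not_sym])
  then have "(\<lambda>h. x $ i * (\<Sum>j\<in>UNIV. axis i 1 $ j * h $ j / x $ j)) = (\<lambda>h. h $ i)"
    by (simp add: axis_def if_distrib[of "\<lambda>c. c * _"] if_distrib[of "\<lambda>c. c / _"] cong: if_cong)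
  then show ?thesis
    unfolding has_log_grad_def
    by (simp add: bounded_linear_imp_has_derivative[OF bounded_linear_vec_nth])
qed

lemma has_log_grad_const: "has_log_grad (\<lambda>y. c) 0 x"
  by (simp add: has_log_grad_def)

lemma has_log_grad_mult:
  assumes "has_log_grad u a x" "has_log_grad v b x"
  shows "has_log_grad (\<lambda>y. u y * v y) (a + b) x"
  using has_derivative_mult[OF assms[unfolded has_log_grad_def]] unfolding has_log_grad_def
  by (simp add: algebra_simps add_divide_distrib sum.distrib)

lemma has_log_grad_power:
  assumes "has_log_grad u a x"
  shows "has_log_grad (\<lambda>y. u y ^ n) (real n *\<^sub>R a) x"
proof (induction n)
  case 0
  then show ?case by (simp add: has_log_grad_const)
next
  case (Suc n)
  from has_log_grad_mult[OF assms this] show ?case by (simp add: algebra_simps)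
qed

text \<open>From d log(u + 1) = du / (u + 1) and du = u d log u. This rule is the source of the
  factors \<mu> and \<nu> in the main proof.\<close>

lemma has_log_grad_add_one:
  assumes "has_log_grad u a x" "u x + 1 \<noteq> 0"
  shows "has_log_grad (\<lambda>y. u y + 1) ((u x / (u x + 1)) *\<^sub>R a) x"
proof -
  have "(\<Sum>i\<in>UNIV. (((u x / (u x + 1)) *\<^sub>R a) $ i) * h $ i / x $ i) =
      u x / (u x + 1) * (\<Sum>i\<in>UNIV. a $ i * h $ i / x $ i)" for h
    by (simp add: sum_distrib_left mult.assoc)
  \<comment> \<open>The trailing \<open>+ 0\<close> is the derivative of the constant 1, in the form
    produced by \<open>has_derivative_add\<close>.\<close>
  then have "(\<lambda>h. (u x + 1) * (\<Sum>i\<in>UNIV. (((u x / (u x + 1)) *\<^sub>R a) $ i) * h $ i / x $ i)) =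
      (\<lambda>h. u x * (\<Sum>i\<in>UNIV. a $ i * h $ i / x $ i) + 0)"
    using assms(2) by simp
  moreover have "((\<lambda>y. u y + 1) has_derivative
      (\<lambda>h. u x * (\<Sum>i\<in>UNIV. a $ i * h $ i / x $ i) + 0)) (at x)"
    using assms(1) unfolding has_log_grad_def
    by (intro has_derivative_add has_derivative_const)
  ultimately show ?thesis unfolding has_log_grad_def by (simp only:)
qed

lemma has_log_grad_divide:
  assumes "has_log_grad u a x" "has_log_grad v b x" "v x \<noteq> 0"
  shows "has_log_grad (\<lambda>y. u y / v y) (a - b) x"
proof -
  have sub: "(\<Sum>i\<in>UNIV. (a - b) $ i * h $ i / x $ i) =
      (\<Sum>i\<in>UNIV. a $ i * h $ i / x $ i) - (\<Sum>i\<in>UNIV. b $ i * h $ i / x $ i)" for h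
    by (simp add: left_diff_distrib diff_divide_distrib sum_subtractf)
  have quot: "(u x * A * v x - u x * (v x * B)) / (v x * v x) = u x / v x * (A - B)" for A B
    using assms(3) by (simp add: field_simps)
  show ?thesis
    using has_derivative_divide'[OF assms[unfolded has_log_grad_def]]
    unfolding has_log_grad_def sub quot .
qed

text \<open>The vectors \<open>A k\<close> are the rows of the Jacobian of \<phi> in logarithmic
  coordinates. The last hypothesis is the matrix identity A C A^T = C: this Jacobian preserves the
  constant form \<open>C\<close>.\<close>

lemma log_canonical_bracket_comp:
  assumes x: "x \<in> pos_orthant"
    and f: "f differentiable (at (\<phi> x))" and g: "g differentiable (at (\<phi> x))"
    and \<phi>: "\<And>k. has_log_grad (\<lambda>y. \<phi> y $ k) (A k) x"
    and C: "\<And>k l. (\<Sum>i\<in>UNIV. \<Sum>j\<in>UNIV. C $ i $ j * A k $ i * A l $ j) = C $ k $ l"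
  shows "log_canonical_bracket C (f \<circ> \<phi>) (g \<circ> \<phi>) x = (log_canonical_bracket C f g \<circ> \<phi>) x"
proof -
  have x0: "x $ i \<noteq> 0" for i
    using x by (simp add: pos_orthant_def less_imp_neq[THEN not_sym])
  \<comment> \<open>The operator x_i d/dx_i is differentiation in log x_i; its factor x_i cancels
    the denominator in \<open>has_log_grad\<close>.\<close>
  have pd: "x $ i * partial_deriv i (u \<circ> \<phi>) x =
      (\<Sum>k\<in>UNIV. partial_deriv k u (\<phi> x) * \<phi> x $ k * A k $ i)"
    if u: "u differentiable (at (\<phi> x))" for u i
  proof -
    have *: "(\<Sum>j\<in>UNIV. A k $ j * axis i 1 $ j / x $ j) = A k $ i / x $ i" for k
      by (simp add: axis_def if_distrib[of "\<lambda>c. _ * c"] if_distrib[of "\<lambda>c. c / _"] cong: if_cong)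
    have "partial_deriv i (u \<circ> \<phi>) x =
        (\<Sum>k\<in>UNIV. partial_deriv k u (\<phi> x) * (\<phi> x $ k * (A k $ i / x $ i)))"
      unfolding partial_deriv_def[of i "u \<circ> \<phi>"]
      by (simp add: frechet_derivative_eqI[OF has_derivative_comp_vec[OF u \<phi>[unfolded has_log_grad_def]]] *)
    then show ?thesis using x0[of i] by (simp add: sum_distrib_left mult.assoc)
  qed
  let ?F = "\<lambda>k. partial_deriv k f (\<phi> x) * \<phi> x $ k"
  let ?G = "\<lambda>l. partial_deriv l g (\<phi> x) * \<phi> x $ l"
  have "log_canonical_bracket C (f \<circ> \<phi>) (g \<circ> \<phi>) x =
      (\<Sum>i\<in>UNIV. \<Sum>j\<in>UNIV. C $ i $ j * (x $ i * partial_deriv i (f \<circ> \<phi>) x) *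
        (x $ j * partial_deriv j (g \<circ> \<phi>) x))"
    by (simp add: log_canonical_bracket_def mult_ac)
  also have "\<dots> = (\<Sum>i\<in>UNIV. \<Sum>j\<in>UNIV. \<Sum>k\<in>UNIV. \<Sum>l\<in>UNIV.
      ?F k * ?G l * (C $ i $ j * A k $ i * A l $ j))"
    by (simp add: pd f g sum_product sum_distrib_left mult_ac)
  \<comment> \<open>The sums over i and j are moved innermost, where A C A^T = C collapses
    them.\<close>
  also have "\<dots> = (\<Sum>i\<in>UNIV. \<Sum>k\<in>UNIV. \<Sum>j\<in>UNIV. \<Sum>l\<in>UNIV.
      ?F k * ?G l * (C $ i $ j * A k $ i * A l $ j))"
    by (rule sum.cong[OF refl], rule sum.swap)
  also have "\<dots> = (\<Sum>k\<in>UNIV. \<Sum>i\<in>UNIV. \<Sum>l\<in>UNIV. \<Sum>j\<in>UNIV.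
      ?F k * ?G l * (C $ i $ j * A k $ i * A l $ j))"
    by (rule trans[OF sum.swap], rule sum.cong[OF refl], rule sum.cong[OF refl], rule sum.swap)
  also have "\<dots> = (\<Sum>k\<in>UNIV. \<Sum>l\<in>UNIV. \<Sum>i\<in>UNIV. \<Sum>j\<in>UNIV.
      ?F k * ?G l * (C $ i $ j * A k $ i * A l $ j))"
    by (rule sum.cong[OF refl], rule sum.swap)
  also have "\<dots> = (\<Sum>k\<in>UNIV. \<Sum>l\<in>UNIV. ?F k * ?G l * C $ k $ l)"
    by (simp flip: sum_distrib_left add: C)
  also have "\<dots> = (log_canonical_bracket C f g \<circ> \<phi>) x"
    by (simp add: log_canonical_bracket_def mult_ac)
  finally show ?thesis .
qed

section \<open>The map \<open>\<phi>\<close>\<close>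

text \<open>In the last equation x_5 appears as the third component of the image, so facts proved
  for that component can be reused for x_6.\<close>

lemma phi_nth:
  "phi r s t p x $ 1 = x $ 3"
  "phi r s t p x $ 2 = x $ 4"
  "phi r s t p x $ 3 = (x $ 2 ^ r * x $ 3 ^ s * x $ 4 ^ t + 1) / x $ 1"
  "phi r s t p x $ 4 = (x $ 3 ^ t * x $ 4 ^ p * phi r s t p x $ 3 ^ r + 1) / x $ 2"
  by (simp_all add: phi_def Let_def)

lemma phi_pos_orthant:
  assumes "x \<in> pos_orthant"
  shows "phi r s t p x \<in> pos_orthant"
proof -
  have pos: "0 < x $ i" for i using assms by (simp add: pos_orthant_def)
  have 3: "0 < phi r s t p x $ 3"
    unfolding phi_nth by (intro divide_pos_pos add_pos_pos mult_pos_pos zero_less_power pos) simp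
  have "0 < phi r s t p x $ 4"
    unfolding phi_nth(4)
    by (intro divide_pos_pos add_pos_pos mult_pos_pos zero_less_power pos 3) simp
  with 3 pos show ?thesis by (simp add: pos_orthant_def forall_4 phi_nth(1,2))
qed

lemma Ck_on_phi: "Ck_on k pos_orthant (\<lambda>x. phi r s t p x $ i)"
proof -
  have coord: "Ck_on k pos_orthant (\<lambda>x :: real ^ 4. x $ j)" for j
    by (intro Ck_on_bounded_linear open_pos_orthant bounded_linear_vec_nth)
  have ne: "x $ j \<noteq> 0" if "x \<in> pos_orthant" for x :: "real ^ 4" and j
    using that by (simp add: pos_orthant_def less_imp_neq[THEN not_sym])
  note intros = Ck_on_divide Ck_on_add Ck_on_mult Ck_on_power Ck_on_const open_pos_orthant coord ne
  have 3: "Ck_on k pos_orthant (\<lambda>x. phi r s t p x $ 3)"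
    unfolding phi_nth by (intro intros)
  have 4: "Ck_on k pos_orthant (\<lambda>x. phi r s t p x $ 4)"
    unfolding phi_nth(4) by (intro intros 3)
  show ?thesis
    using exhaust_4[of i] 3 4 coord by (auto simp: phi_nth(1,2))
qed

theorem mainTheorem3:
  fixes r s t p :: nat
  assumes "0 < r" and "0 < s" and "0 < t" and "0 < p"
    and "(r, s) \<noteq> (t, p)"
  shows "poisson_map pos_orthant (log_canonical_bracket (coeff_matrix r s t p)) (phi r s t p)"
proof -
  let ?\<phi> = "phi r s t p"
  have maps: "?\<phi> ` pos_orthant \<subseteq> pos_orthant"
    by (auto intro: phi_pos_orthant)
  have "log_canonical_bracket (coeff_matrix r s t p) (f \<circ> ?\<phi>) (g \<circ> ?\<phi>) x =
      (log_canonical_bracket (coeff_matrix r s t p) f g \<circ> ?\<phi>) x"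
    if f: "f \<in> Cinf pos_orthant" and g: "g \<in> Cinf pos_orthant" and x: "x \<in> pos_orthant" for f g x
  proof -
    define m where "m y = y $ 2 ^ r * y $ 3 ^ s * y $ 4 ^ t" for y :: "real ^ 4"
    define n where "n y = y $ 3 ^ t * y $ 4 ^ p * ?\<phi> y $ 3 ^ r" for y
    define \<mu> where "\<mu> = m x / (m x + 1)"
    define \<nu> where "\<nu> = n x / (n x + 1)"
    define e where "e i = (axis i 1 :: real ^ 4)" for i
    \<comment> \<open>The coefficients are the exponents of \<open>m\<close> and \<open>n\<close>;
      the subtracted basis vectors come from the denominators x_1 and x_2. In \<open>a4\<close>, the
      factor x_5^r of \<open>n\<close> contributes r times \<open>a3\<close>.\<close>
    define a3 where "a3 = \<mu> *\<^sub>R (real r *\<^sub>R e 2 + real s *\<^sub>R e 3 + real t *\<^sub>R e 4) - e 1"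
    define a4 where "a4 = \<nu> *\<^sub>R (real t *\<^sub>R e 3 + real p *\<^sub>R e 4 + real r *\<^sub>R a3) - e 2"
    define A where "A k = (if k = 1 then e 3 else if k = 2 then e 4 else if k = 3 then a3 else a4)"
      for k :: 4
    have pos: "0 < x $ i" "0 < ?\<phi> x $ i" for i
      using x phi_pos_orthant[OF x] by (auto simp: pos_orthant_def)
    then have m_pos: "0 < m x" and n_pos: "0 < n x"
      by (simp_all add: m_def n_def)
    note coord = has_log_grad_coord[OF x, folded e_def]
    have a3: "has_log_grad (\<lambda>y. ?\<phi> y $ 3) a3 x"
      unfolding phi_nth(3) m_def[symmetric] a3_def \<mu>_def
    proof (intro has_log_grad_divide has_log_grad_add_one coord)
      show "has_log_grad m (real r *\<^sub>R e 2 + real s *\<^sub>R e 3 + real t *\<^sub>R e 4) x"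
        unfolding m_def[abs_def] by (intro has_log_grad_mult has_log_grad_power coord)
    qed (use pos(1)[of 1] m_pos in auto)
    have a4: "has_log_grad (\<lambda>y. ?\<phi> y $ 4) a4 x"
      unfolding phi_nth(4) n_def[symmetric] a4_def \<nu>_def
    proof (intro has_log_grad_divide has_log_grad_add_one coord)
      show "has_log_grad n (real t *\<^sub>R e 3 + real p *\<^sub>R e 4 + real r *\<^sub>R a3) x"
        unfolding n_def[abs_def] by (intro has_log_grad_mult has_log_grad_power coord a3)
    qed (use pos(1)[of 2] n_pos in auto)
    have "has_log_grad (\<lambda>y. ?\<phi> y $ k) (A k) x" for k
      using exhaust_4[of k] coord[of 3] coord[of 4] a3 a4 by (auto simp: A_def phi_nth(1,2))
    moreover have "(\<Sum>i\<in>UNIV. \<Sum>j\<in>UNIV. coeff_matrix r s t p $ i $ j * A k $ i * A l $ j) =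
        coeff_matrix r s t p $ k $ l" for k l
    proof -
      have A_nth:
        "A 1 $ 1 = 0" "A 1 $ 2 = 0" "A 1 $ 3 = 1" "A 1 $ 4 = 0"
        "A 2 $ 1 = 0" "A 2 $ 2 = 0" "A 2 $ 3 = 0" "A 2 $ 4 = 1"
        "A 3 $ 1 = - 1" "A 3 $ 2 = \<mu> * r" "A 3 $ 3 = \<mu> * s" "A 3 $ 4 = \<mu> * t"
        "A 4 $ 1 = - \<nu> * r" "A 4 $ 2 = \<nu> * r * (\<mu> * r) - 1"
        "A 4 $ 3 = \<nu> * (t + r * (\<mu> * s))" "A 4 $ 4 = \<nu> * (p + r * (\<mu> * t))"
        by (simp_all add: A_def a4_def a3_def e_def axis_def)
      \<comment> \<open>These sixteen identities are polynomial in \<mu> and \<nu> and hold for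
        arbitrary values of both: all terms containing them cancel. For instance, pairing e_3 with
        \<open>a3\<close> gives -p + \<mu> (r t - t r) = -p.\<close>
      have "\<forall>k l. (\<Sum>i\<in>UNIV. \<Sum>j\<in>UNIV. coeff_matrix r s t p $ i $ j * A k $ i * A l $ j) =
          coeff_matrix r s t p $ k $ l"
        unfolding forall_4 sum_4
        by (simp add: A_nth coeff_matrix_def algebra_simps)
      then show ?thesis by blast
    qed
    moreover have "f differentiable (at (?\<phi> x))" "g differentiable (at (?\<phi> x))"
      using f g phi_pos_orthant[OF x] by (auto intro: Cinf_differentiable)
    ultimately show ?thesis
      using x by (intro log_canonical_bracket_comp)
  qed
  moreover have "f \<circ> ?\<phi> \<in> Cinf pos_orthant" if "f \<in> Cinf pos_orthant" for f
    using open_pos_orthant maps that Ck_on_phi by (rule Cinf_comp)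
  ultimately show ?thesis
    using maps unfolding poisson_map_def by blast
qed

end
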